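(* Let the schema consist of a single binary relation symbol $R$, and let $\mathbf{T}''$ be the unary CQ $\mathbf{T}''(x)\text{ :- }R(y_1,y_2)\wedge R(y_2,y_3)\wedge R(y_3,y_4)\wedge R(y_4,y_5)\wedge\bigwedge_{i=1}^{5}R(x,y_i)$. There is no pair $(E^+,E^-)$ of finite sets of c-acyclic structures with one distinguished element that uniquely characterizes $\mathbf{T}''$ with respect to the class of unary c-acyclic c-connected CQs.
   Context: A unary CQ is $q(x)\text{ :- }\alpha_1\wedge\dots\wedge\alpha_n$ with atoms $\alpha_i$ (other variables existentially quantified), where $x$ occurs in some atom; its canonical structure has its variables as elements, its atoms as facts, and $x$ as distinguished element. A structure with one distinguished element $(A,a)$ is a positive example for $q$ if $a\in q(A)$ (equivalently the canonical structure of $q$ maps homomorphically to $(A,a)$ with $x\mapsto a$), negative otherwise. Unary CQs are logically equivalent if they have the same answers on every structure. $(E^+,E^-)$ uniquely characterizes $q$ w.r.t. a class $\mathcal{C}$ if all of $E^+$ are positive and all of $E^-$ negative for $q$, and every $q'\in\mathcal{C}$ with this property is logically equivalent to $q$. The incidence graph of a structure is the bipartite multigraph on its elements and facts with one edge per occurrence of an element in a fact; a structure is c-acyclic if every cycle of its incidence graph (including length-2 cycles from parallel edges) passes through a distinguished element, and c-connected if every connected component of its incidence graph contains a distinguished element; a CQ has these properties if its canonical structure does.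
   Formalization: The example structures are taken to be finite; with infinite structures the claim fails, since gluing at the distinguished element all c-acyclic c-connected CQs into which T'' does not map gives one negative example that, with T'' as positive example, characterizes T''. *)

theory Defs
  imports Main
begin

text \<open>
  The schema is a single binary relation symbol \<open>R\<close>, so the fact or atom \<open>R(u,v)\<close> is represented
  by the pair \<open>(u,v)\<close>. Structures are finite; an element need not occur in a fact.
\<close>

record 'a struct =
  Dom :: "'a set"
  Rel :: "('a \<times> 'a) set"

type_synonym 'a pstruct = "'a struct \<times> 'a"

definition is_struct :: "'a struct \<Rightarrow> bool" where
  "is_struct A \<longleftrightarrow> finite (Dom A) \<and> Rel A \<subseteq> Dom A \<times> Dom A"

definition is_pstruct :: "'a pstruct \<Rightarrow> bool" where
  "is_pstruct E \<longleftrightarrow> is_struct (fst E) \<and> snd E \<in> Dom (fst E)"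

text \<open>
  Nodes of the incidence graph are elements (\<open>Inl\<close>) and facts (\<open>Inr\<close>). The edges \<open>(f, False)\<close> and
  \<open>(f, True)\<close> stand for the first and second argument position of the fact \<open>f\<close>; for \<open>f = (b,b)\<close>
  they are parallel.
\<close>

definition incidence_nodes :: "'a struct \<Rightarrow> ('a + 'a \<times> 'a) set" where
  "incidence_nodes A = Inl ` Dom A \<union> Inr ` Rel A"

definition incidence_edges :: "'a struct \<Rightarrow> (('a \<times> 'a) \<times> bool) set" where
  "incidence_edges A = Rel A \<times> UNIV"

fun incidence_ends :: "('a \<times> 'a) \<times> bool \<Rightarrow> ('a + 'a \<times> 'a) set" where
  "incidence_ends (f, p) = {Inr f, Inl (if p then snd f else fst f)}"

text \<open>
  A cycle is given by its nodes and its edges, both listed without repetition. Distinctness of the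
  edges matters only for cycles of length 2, which must consist of two parallel edges.
\<close>

definition incidence_cycle ::
  "'a struct \<Rightarrow> ('a + 'a \<times> 'a) list \<Rightarrow> (('a \<times> 'a) \<times> bool) list \<Rightarrow> bool" where
  "incidence_cycle A vs es \<longleftrightarrow>
     vs \<noteq> [] \<and> length es = length vs \<and> distinct vs \<and> distinct es \<and>
     set vs \<subseteq> incidence_nodes A \<and> set es \<subseteq> incidence_edges A \<and>
     (\<forall>i<length vs. incidence_ends (es ! i) = {vs ! i, vs ! (Suc i mod length vs)})"

definition c_acyclic :: "'a pstruct \<Rightarrow> bool" where
  "c_acyclic E \<longleftrightarrow> (\<forall>vs es. incidence_cycle (fst E) vs es \<longrightarrow> Inl (snd E) \<in> set vs)"

definition incidence_adj :: "'a struct \<Rightarrow> ('a + 'a \<times> 'a) rel" where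
  "incidence_adj A = {(u, v). \<exists>e \<in> incidence_edges A. incidence_ends e = {u, v}}"

definition incidence_components :: "'a struct \<Rightarrow> ('a + 'a \<times> 'a) set set" where
  "incidence_components A = incidence_nodes A // Restr ((incidence_adj A)\<^sup>*) (incidence_nodes A)"

definition c_connected :: "'a pstruct \<Rightarrow> bool" where
  "c_connected E \<longleftrightarrow> (\<forall>C \<in> incidence_components (fst E). Inl (snd E) \<in> C)"

text \<open>
  In \<open>CQ x \<alpha>s\<close> the answer variable is \<open>x\<close> and all other variables of the atoms \<open>\<alpha>s\<close> are
  existentially quantified.
\<close>

datatype cq = CQ (answer_var: nat) (atoms: "(nat \<times> nat) list")

definition vars :: "cq \<Rightarrow> nat set" where
  "vars q = fst ` set (atoms q) \<union> snd ` set (atoms q)"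

definition is_cq :: "cq \<Rightarrow> bool" where
  "is_cq q \<longleftrightarrow> answer_var q \<in> vars q"

definition canonical :: "cq \<Rightarrow> nat pstruct" where
  "canonical q = (\<lparr>Dom = vars q, Rel = set (atoms q)\<rparr>, answer_var q)"

definition answers :: "cq \<Rightarrow> 'a struct \<Rightarrow> 'a set" where
  "answers q A = {a. \<exists>h. h ` vars q \<subseteq> Dom A \<and> h (answer_var q) = a \<and>
                        (\<forall>(u, v) \<in> set (atoms q). (h u, h v) \<in> Rel A)}"

definition positive_example :: "cq \<Rightarrow> 'a pstruct \<Rightarrow> bool" where
  "positive_example q E \<longleftrightarrow> snd E \<in> answers q (fst E)"

definition fits :: "'a pstruct set \<Rightarrow> 'a pstruct set \<Rightarrow> cq \<Rightarrow> bool" where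
  "fits Epos Eneg q \<longleftrightarrow>
     (\<forall>E \<in> Epos. positive_example q E) \<and> (\<forall>E \<in> Eneg. \<not> positive_example q E)"

text \<open>Every finite structure has an isomorphic copy over the natural numbers.\<close>

definition logically_equivalent :: "cq \<Rightarrow> cq \<Rightarrow> bool" where
  "logically_equivalent q q' \<longleftrightarrow>
     (\<forall>A :: nat struct. is_struct A \<longrightarrow> answers q A = answers q' A)"

definition uniquely_characterizes ::
  "'a pstruct set \<Rightarrow> 'a pstruct set \<Rightarrow> cq \<Rightarrow> cq set \<Rightarrow> bool" where
  "uniquely_characterizes Epos Eneg q \<C> \<longleftrightarrow>
     fits Epos Eneg q \<and> (\<forall>q' \<in> \<C>. fits Epos Eneg q' \<longrightarrow> logically_equivalent q' q)"

definition c_acyclic_c_connected_cqs :: "cq set" where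
  "c_acyclic_c_connected_cqs = {q. is_cq q \<and> c_acyclic (canonical q) \<and> c_connected (canonical q)}"

text \<open>Variable \<open>0\<close> is \<open>x\<close>, and variable \<open>i\<close> is \<open>y\<^sub>i\<close> for \<open>i = 1, \<dots>, 5\<close>.\<close>

definition T'' :: cq where
  "T'' = CQ 0 [(1,2), (2,3), (3,4), (4,5), (0,1), (0,2), (0,3), (0,4), (0,5)]"

end

theory Submission
  imports Defs
begin

text \<open>
  The competing queries have an edge from \<open>x\<close> to every other variable; the other variables form an
  oriented comb whose spine follows the pattern \<open>a \<rightarrow> c \<leftarrow> b \<leftarrow> d \<rightarrow> a \<rightarrow> \<dots>\<close>, where a directed
  path of length two ends in every \<open>a\<close> and \<open>c\<close>, and one starts in every \<open>b\<close> and \<open>d\<close>. The comb is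
  balanced with five levels, so it maps to the directed path of \<open>T''\<close> and every positive example of
  \<open>T''\<close> is one of the competitor. It also maps to the transitive tournament on four vertices,
  to which the path does not map, so the queries are not equivalent. Finally, suppose that
  the competitor maps to a negative example of \<open>T''\<close>. Two spine vertices at distance two cannot have the
  same image, because the path ending in one and the path starting in the other would combine to an
  image of the path of \<open>T''\<close>. Hence the spine becomes a walk without backtracking that avoids the
  distinguished element. If the spine is longer than the size of the example, such a walk closes
  a cycle, contradicting c-acyclicity.
\<close>

section \<open>Cycles in incidence graphs\<close>

text \<open>The two edges are those leaving and entering the position of \<open>z\<close>. They
  differ because a cycle of length one would need an edge whose ends, a fact and an element,
  coincide.\<close>

lemma incidence_cycle_two_edges:
  assumes cyc: "incidence_cycle A vs es" and z: "z \<in> set vs"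
  obtains e1 e2 where "e1 \<in> set es" "e2 \<in> set es" "e1 \<noteq> e2"
    "z \<in> incidence_ends e1" "z \<in> incidence_ends e2"
proof -
  let ?n = "length vs"
  have len: "length es = ?n" and dist: "distinct es"
    and ends: "\<And>i. i < ?n \<Longrightarrow> incidence_ends (es ! i) = {vs ! i, vs ! (Suc i mod ?n)}"
    using cyc by (auto simp: incidence_cycle_def)
  obtain i where i: "i < ?n" "vs ! i = z" using z by (auto simp: in_set_conv_nth)
  have "?n \<noteq> 1"
  proof
    assume n: "?n = 1"
    obtain f p where "es ! 0 = (f, p)" by fastforce
    then have "{Inr f, Inl (if p then snd f else fst f)} = {vs ! 0}" using ends[of 0] n by simp
    then show False by (metis Inl_Inr_False insertI1 insertI2 singletonD)
  qed
  define j where "j = (if i = 0 then ?n - 1 else i - 1)"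
  have j: "j < ?n" "j \<noteq> i" "Suc j mod ?n = i" using i(1) \<open>?n \<noteq> 1\<close> by (auto simp: j_def)
  show thesis
  proof (rule that[of "es ! i" "es ! j"])
    show "es ! i \<noteq> es ! j" using j i len dist by (simp add: nth_eq_iff_index_eq)
  qed (use i j len ends in auto)
qed

lemma incidence_cycle_ends:
  assumes cyc: "incidence_cycle A vs es" and e: "e \<in> set es"
  shows "incidence_ends e \<subseteq> set vs"
proof -
  obtain i where "i < length es" "es ! i = e" using e by (auto simp: in_set_conv_nth)
  moreover from this have "i < length vs" "Suc i mod length vs < length vs"
    using cyc by (auto simp: incidence_cycle_def intro!: mod_less_divisor)
  ultimately show ?thesis using cyc by (auto simp: incidence_cycle_def)
qed

text \<open>
  Injectivity of \<open>max\<close> says that every element is joined to at most one smaller element, by a single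
  fact. So the largest element of a cycle that avoids \<open>x\<close> cannot have two neighbours on the cycle.
\<close>

lemma c_acyclicI_inj_on_max:
  fixes A :: "('a :: linorder) struct"
  assumes irrefl: "\<And>u. u \<noteq> x \<Longrightarrow> (u, u) \<notin> Rel A"
    and inj: "inj_on (\<lambda>(u, v). max u v) {(u, v) \<in> Rel A. u \<noteq> x \<and> v \<noteq> x}"
  shows "c_acyclic (A, x)"
  unfolding c_acyclic_def
proof (intro allI impI, rule ccontr)
  fix vs es
  assume "incidence_cycle (fst (A, x)) vs es" and "Inl (snd (A, x)) \<notin> set vs"
  then have cyc: "incidence_cycle A vs es" and x: "Inl x \<notin> set vs" by auto
  define S where "S = {v. Inl v \<in> set vs}"
  \<comment> \<open>The two cycle edges at a fact must be its two argument positions, so both of its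
    elements lie on the cycle.\<close>
  have fact_ends: "f \<in> Rel A" "fst f \<in> S" "snd f \<in> S" if e: "(f, p) \<in> set es" for f p
  proof -
    have "Inr f \<in> set vs" using incidence_cycle_ends[OF cyc e] by auto
    then obtain e1 e2 where e12: "e1 \<in> set es" "e2 \<in> set es" "e1 \<noteq> e2"
      "Inr f \<in> incidence_ends e1" "Inr f \<in> incidence_ends e2"
      by (rule incidence_cycle_two_edges[OF cyc])
    have "fst e = f" if "Inr f \<in> incidence_ends e" for e
      using that by (cases e) simp
    from this[OF e12(4)] this[OF e12(5)] obtain p1 p2 where "e1 = (f, p1)" "e2 = (f, p2)"
      by (metis prod.collapse)
    then have "(f, False) \<in> set es" "(f, True) \<in> set es"
      using e12(1-3) by (cases p1; cases p2; simp)+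
    then show "fst f \<in> S" "snd f \<in> S"
      using incidence_cycle_ends[OF cyc, of "(f, False)"] incidence_cycle_ends[OF cyc, of "(f, True)"]
      by (simp_all add: S_def)
    show "f \<in> Rel A" using e cyc by (auto simp: incidence_cycle_def incidence_edges_def)
  qed
  have "finite S"
    using finite_vimageI[of "set vs" Inl] by (simp add: S_def vimage_def)
  obtain f0 p0 where "(f0, p0) \<in> set es"
    using cyc by (cases es) (auto simp: incidence_cycle_def)
  then have "S \<noteq> {}" using fact_ends by blast
  define M where "M = Max S"
  have "M \<in> S" and le: "\<And>v. v \<in> S \<Longrightarrow> v \<le> M"
    using \<open>finite S\<close> \<open>S \<noteq> {}\<close> by (auto simp: M_def)
  then have "Inl M \<in> set vs" by (simp add: S_def)
  then obtain e1 e2 where e: "e1 \<in> set es" "e2 \<in> set es" "e1 \<noteq> e2"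
    "Inl M \<in> incidence_ends e1" "Inl M \<in> incidence_ends e2"
    by (rule incidence_cycle_two_edges[OF cyc])
  obtain f1 p1 f2 p2 where e12: "e1 = (f1, p1)" "e2 = (f2, p2)" by fastforce
  have max: "f \<in> {(u, v) \<in> Rel A. u \<noteq> x \<and> v \<noteq> x} \<and> (case f of (u, v) \<Rightarrow> max u v) = M"
    if "(f, p) \<in> set es" "Inl M \<in> incidence_ends (f, p)" for f p
  proof -
    obtain u v where f: "f = (u, v)" by fastforce
    have "(u, v) \<in> Rel A" "u \<in> S" "v \<in> S" using fact_ends[OF that(1)] by (simp_all add: f)
    moreover from this x have "u \<noteq> x" "v \<noteq> x" by (auto simp: S_def)
    moreover have "u = M \<or> v = M" using that(2) by (simp add: f split: if_splits)
    ultimately show ?thesis using le[of u] le[of v] by (auto simp: f max_absorb1 max_absorb2)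
  qed
  have f1: "(f1, p1) \<in> set es" "Inl M \<in> incidence_ends (f1, p1)"
    and f2: "(f2, p2) \<in> set es" "Inl M \<in> incidence_ends (f2, p2)"
    using e e12 by simp_all
  have "f1 = f2"
  proof (rule inj_onD[OF inj])
    show "(case f1 of (u, v) \<Rightarrow> max u v) = (case f2 of (u, v) \<Rightarrow> max u v)"
      using max[OF f1] max[OF f2] by (simp only:)
  qed (use max[OF f1] max[OF f2] in \<open>simp_all only:\<close>)
  \<comment> \<open>Both edges at \<open>M\<close> belong to one fact, in different positions, so
    this fact is a loop at \<open>M\<close>.\<close>
  then have "p1 \<noteq> p2" using e(3) e12 by simp
  with f1(2) f2(2) \<open>f1 = f2\<close> have "f1 = (M, M)" by (cases f1) (auto split: if_splits)
  then show False using max[OF f1] irrefl[of M] by simp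
qed

text \<open>Interleave the walk with facts: \<open>v m\<close> becomes node \<open>2 * m\<close>,
  and a fact joining it to \<open>v (Suc m)\<close> becomes node \<open>2 * m + 1\<close>. The bound
  \<open>3 \<le> k\<close> keeps two steps from using one fact in opposite directions.\<close>

lemma incidence_cycle_of_closed_walk:
  assumes k: "3 \<le> k" and closed: "v k = v 0" and inj: "inj_on v {..<k}"
    and dom: "v ` {..<k} \<subseteq> Dom A"
    and adj: "\<And>m. m < k \<Longrightarrow> (v m, v (Suc m)) \<in> Rel A \<or> (v (Suc m), v m) \<in> Rel A"
  obtains vs es where "incidence_cycle A vs es" "\<And>u. Inl u \<in> set vs \<Longrightarrow> u \<in> v ` {..<k}"
proof -
  define s where "s m = ((v m, v (Suc m)) \<in> Rel A)" for m
  define f where "f m = (if s m then (v m, v (Suc m)) else (v (Suc m), v m))" for m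
  have fR: "f m \<in> Rel A" if "m < k" for m using adj[OF that] by (auto simp: f_def s_def)
  have veq: "v m = v m' \<longleftrightarrow> m = m'" if "m < k" "m' < k" for m m'
    using inj that by (auto simp: inj_on_def)
  have vSuc: "v (Suc m) = v m' \<longleftrightarrow> Suc m = m' \<or> Suc m = k \<and> m' = 0" if "m < k" "m' < k" for m m'
    using veq[of "Suc m" m'] veq[of 0 m'] that closed by (cases "Suc m = k") auto
  have finj: "m = m'" if m: "m < k" "m' < k" and eq: "f m = f m'" for m m'
  proof (rule ccontr)
    assume "m \<noteq> m'"
    then have "v (Suc m) = v m'" "v (Suc m') = v m"
      using eq veq[OF m] by (auto simp: f_def split: if_splits)
    then show False using vSuc[of m m'] vSuc[of m' m] m k by auto
  qed
  define node where "node n = (if even n then Inl (v (n div 2)) else Inr (f (n div 2)))" for n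
  \<comment> \<open>The flag selects the argument position holding \<open>v m\<close> if
    \<open>n = 2 * m\<close>, and \<open>v (Suc m)\<close> if \<open>n = 2 * m + 1\<close>.\<close>
  define edge where "edge n = (f (n div 2), if even n then \<not> s (n div 2) else s (n div 2))" for n
  have half: "n = m" if "n div 2 = m div 2" "even n = even m" for n m :: nat
    using that by (metis dvd_mult_div_cancel odd_two_times_div_two_succ)
  have ninj: "inj_on node {..<2 * k}"
  proof (rule inj_onI)
    fix n m assume "n \<in> {..<2 * k}" "m \<in> {..<2 * k}" "node n = node m"
    then show "n = m"
      using veq[of "n div 2" "m div 2"] finj[of "n div 2" "m div 2"] half[of n m]
      by (auto simp: node_def split: if_splits)
  qed
  have einj: "inj_on edge {..<2 * k}"
  proof (rule inj_onI)
    fix n m assume nm: "n \<in> {..<2 * k}" "m \<in> {..<2 * k}" "edge n = edge m"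
    then have "n div 2 = m div 2" using finj[of "n div 2" "m div 2"] by (auto simp: edge_def)
    then show "n = m" using half[of n m] nm by (auto simp: edge_def split: if_splits)
  qed
  have ends: "incidence_ends (edge n) = {node n, node (Suc n mod (2 * k))}" if "n < 2 * k" for n
  proof (cases "even n")
    case True
    then have "Suc n < 2 * k" using that by presburger
    with True show ?thesis by (auto simp: edge_def node_def f_def)
  next
    case False
    then obtain m where m: "n = Suc (2 * m)" by (metis oddE Suc_eq_plus1)
    with that have "m < k" by simp
    have "node (Suc n mod (2 * k)) = Inl (v (Suc m))"
    proof (cases "Suc m = k")
      case True
      then have "Suc n = 2 * k" using m by simp
      then show ?thesis using closed True by (simp add: node_def)
    next
      case False
      then show ?thesis using \<open>m < k\<close> m by (simp add: node_def)
    qed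
    then show ?thesis by (auto simp: m edge_def node_def f_def)
  qed
  define vs where "vs = map node [0..<2 * k]"
  define es where "es = map edge [0..<2 * k]"
  have "set vs \<subseteq> incidence_nodes A"
    using dom fR
    by (auto simp: vs_def node_def incidence_nodes_def image_subset_iff less_mult_imp_div_less mult.commute)
  moreover have "set es \<subseteq> incidence_edges A"
    using fR by (auto simp: es_def edge_def incidence_edges_def less_mult_imp_div_less mult.commute)
  ultimately have "incidence_cycle A vs es"
    using k ninj einj ends
    by (auto simp: incidence_cycle_def vs_def es_def distinct_map atLeast0LessThan)
  moreover have "u \<in> v ` {..<k}" if "Inl u \<in> set vs" for u
    using that by (auto simp: vs_def node_def split: if_splits)
  ultimately show thesis using that by blast
qed

text \<open>By pigeonhole the walk repeats an element. A repetition at the least distance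
  \<open>k\<close> bounds a stretch of distinct elements, and loops and backtracking being excluded,
  \<open>3 \<le> k\<close>.\<close>

lemma incidence_cycle_of_nonbacktracking_walk:
  assumes fin: "finite (Dom A)" and dom: "w ` {..<L} \<subseteq> Dom A" and card: "card (Dom A) < L"
    and adj: "\<And>n. Suc n < L \<Longrightarrow> (w n, w (Suc n)) \<in> Rel A \<or> (w (Suc n), w n) \<in> Rel A"
    and no_loop: "\<And>n. Suc n < L \<Longrightarrow> w n \<noteq> w (Suc n)"
    and no_backtrack: "\<And>n. Suc (Suc n) < L \<Longrightarrow> w n \<noteq> w (Suc (Suc n))"
  obtains vs es where "incidence_cycle A vs es" "\<And>u. Inl u \<in> set vs \<Longrightarrow> u \<in> w ` {..<L}"
proof -
  define P where "P k \<longleftrightarrow> 0 < k \<and> (\<exists>i. i + k < L \<and> w i = w (i + k))" for k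
  have "card (w ` {..<L}) < card {..<L}" using card_mono[OF fin dom] card by simp
  then have "\<not> inj_on w {..<L}" by (rule pigeonhole)
  then obtain i j where "i < j" "j < L" "w i = w j"
    unfolding inj_on_def by (metis lessThan_iff linorder_neqE_nat)
  then have "P (j - i)" by (auto simp: P_def intro!: exI[of _ i])
  define k where "k = (LEAST k. P k)"
  have "P k" and least: "\<And>k'. P k' \<Longrightarrow> k \<le> k'"
    using \<open>P (j - i)\<close> unfolding k_def by (rule LeastI, auto intro: Least_le)
  then obtain i where i: "0 < k" "i + k < L" "w i = w (i + k)" by (auto simp: P_def)
  have "k \<noteq> 1" using i no_loop[of i] by auto
  moreover have "k \<noteq> 2" using i no_backtrack[of i] by auto
  ultimately have "3 \<le> k" using i(1) by linarith
  have aux: False if "m < m'" "m' < k" "w (i + m) = w (i + m')" for m m'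
  proof -
    have "P (m' - m)" using that i(2) by (auto simp: P_def intro!: exI[of _ "i + m"])
    then show False using least[of "m' - m"] that by simp
  qed
  show thesis
  proof (rule incidence_cycle_of_closed_walk[of k "\<lambda>m. w (i + m)" A])
    show "inj_on (\<lambda>m. w (i + m)) {..<k}"
      using aux by (auto simp: inj_on_def) (metis linorder_neqE_nat)
    show "(w (i + m), w (i + Suc m)) \<in> Rel A \<or> (w (i + Suc m), w (i + m)) \<in> Rel A" if "m < k" for m
      using adj[of "i + m"] that i(2) by simp
    fix vs es
    assume "incidence_cycle A vs es" "\<And>u. Inl u \<in> set vs \<Longrightarrow> u \<in> (\<lambda>m. w (i + m)) ` {..<k}"
    then show thesis using that[of vs es] i(2) by fastforce
  qed (use \<open>3 \<le> k\<close> i dom in auto)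
qed

text \<open>The fact \<open>(x, v)\<close> links \<open>v\<close> to \<open>x\<close> in two steps,
  and every fact is adjacent to its first element.\<close>

lemma c_connectedI_dominating:
  assumes "is_struct A" and dominating: "\<And>v. v \<in> Dom A \<Longrightarrow> v \<noteq> x \<Longrightarrow> (x, v) \<in> Rel A"
    and x: "x \<in> Dom A"
  shows "c_connected (A, x)"
proof -
  have adj: "(Inr f, Inl (fst f)) \<in> incidence_adj A" "(Inr f, Inl (snd f)) \<in> incidence_adj A"
    "(Inl (snd f), Inr f) \<in> incidence_adj A" if "f \<in> Rel A" for f
  proof -
    have *: "(u, w) \<in> incidence_adj A" if "incidence_ends (f, p) = {u, w}" for u w p
      using that \<open>f \<in> Rel A\<close> by (auto simp: incidence_adj_def incidence_edges_def simp del: incidence_ends.simps)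
    show "(Inr f, Inl (fst f)) \<in> incidence_adj A" "(Inr f, Inl (snd f)) \<in> incidence_adj A"
      "(Inl (snd f), Inr f) \<in> incidence_adj A"
      by (rule *[of False] *[of True], simp add: insert_commute)+
  qed
  have elem: "(Inl v, Inl x) \<in> (incidence_adj A)\<^sup>*" if "v \<in> Dom A" for v
  proof (cases "v = x")
    case False
    with dominating that have "(x, v) \<in> Rel A" by blast
    from adj[OF this] show ?thesis by (auto intro: rtrancl_trans)
  qed simp
  have "(z, Inl x) \<in> (incidence_adj A)\<^sup>*" if "z \<in> incidence_nodes A" for z
  proof (cases z)
    case (Inr f)
    with that have f: "f \<in> Rel A" by (auto simp: incidence_nodes_def)
    then have "fst f \<in> Dom A" using assms(1) by (auto simp: is_struct_def)
    from converse_rtrancl_into_rtrancl[OF adj(1)[OF f] elem[OF this]] show ?thesis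
      using Inr by simp
  qed (use elem that in \<open>auto simp: incidence_nodes_def\<close>)
  then show ?thesis
    using x by (auto simp: c_connected_def incidence_components_def quotient_def incidence_nodes_def)
qed

section \<open>Homomorphisms from queries\<close>

lemma positive_exampleI:
  assumes "is_struct (fst E)" "is_cq q" "h (answer_var q) = snd E"
    and hom: "\<And>u v. (u, v) \<in> set (atoms q) \<Longrightarrow> (h u, h v) \<in> Rel (fst E)"
  shows "positive_example q E"
proof -
  have "h ` vars q \<subseteq> Dom (fst E)"
    using hom assms(1) unfolding vars_def is_struct_def by fastforce
  then show ?thesis
    using assms(3) hom unfolding positive_example_def answers_def by blast
qed

lemma positive_exampleE:
  assumes "positive_example q E"
  obtains h where "h (answer_var q) = snd E"
    "\<forall>(u, v) \<in> set (atoms q). (h u, h v) \<in> Rel (fst E)"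
  using assms unfolding positive_example_def answers_def by blast

text \<open>The five elements may coincide, so that a loop, or two paths glued at a common element,
  can serve as the image of the path.\<close>

lemma positive_example_T''I:
  assumes "is_struct (fst E)"
    and path: "(y1, y2) \<in> Rel (fst E)" "(y2, y3) \<in> Rel (fst E)"
      "(y3, y4) \<in> Rel (fst E)" "(y4, y5) \<in> Rel (fst E)"
    and out: "\<And>y. y \<in> {y1, y2, y3, y4, y5} \<Longrightarrow> (snd E, y) \<in> Rel (fst E)"
  shows "positive_example T'' E"
proof (rule positive_exampleI[where h = "(!) [snd E, y1, y2, y3, y4, y5]"])
  have "(snd E, y1) \<in> Rel (fst E)" "(snd E, y2) \<in> Rel (fst E)" "(snd E, y3) \<in> Rel (fst E)"
    "(snd E, y4) \<in> Rel (fst E)" "(snd E, y5) \<in> Rel (fst E)"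
    using out by blast+
  then show "([snd E, y1, y2, y3, y4, y5] ! u, [snd E, y1, y2, y3, y4, y5] ! v) \<in> Rel (fst E)"
    if "(u, v) \<in> set (atoms T'')" for u v
    using that path by (auto simp: T''_def)
qed (use assms(1) in \<open>simp_all add: T''_def is_cq_def vars_def\<close>)

section \<open>The competing queries\<close>

definition orient :: "bool \<Rightarrow> nat \<Rightarrow> nat \<Rightarrow> nat \<times> nat" where
  "orient b u v = (if b then (u, v) else (v, u))"

text \<open>Residues 0, 1, 2, 3 of a spine position stand for the pattern vertices \<open>a\<close>,
  \<open>c\<close>, \<open>b\<close>, \<open>d\<close>. Tails leave \<open>b\<close> and
  \<open>d\<close>; in \<open>forward\<close>, the spine edges leaving \<open>a\<close> and
  \<open>d\<close> towards the next position are singled out.\<close>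

definition tail_out :: "nat \<Rightarrow> bool" where
  "tail_out n \<longleftrightarrow> 2 \<le> n mod 4"

definition forward :: "nat \<Rightarrow> bool" where
  "forward n \<longleftrightarrow> n mod 4 \<in> {0, 3}"

text \<open>
  The \<open>n\<close>-th spine variable is \<open>3 * n + 1\<close>, and its tail consists of \<open>3 * n + 2\<close> and \<open>3 * n + 3\<close>.
\<close>

definition segment :: "nat \<Rightarrow> (nat \<times> nat) list" where
  "segment n =
     [(0, 3 * n + 1), (0, 3 * n + 2), (0, 3 * n + 3), (0, 3 * n + 4),
      orient (tail_out n) (3 * n + 1) (3 * n + 2),
      orient (tail_out n) (3 * n + 2) (3 * n + 3),
      orient (forward n) (3 * n + 1) (3 * n + 4)]"

definition comb :: "nat \<Rightarrow> cq" where
  "comb L = CQ 0 (concat (map segment [0..<L]))"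

lemma set_atoms_comb: "set (atoms (comb L)) = (\<Union>n<L. set (segment n))"
  by (auto simp: comb_def)

lemma is_cq_comb: "0 < L \<Longrightarrow> is_cq (comb L)"
  by (force simp: is_cq_def vars_def set_atoms_comb comb_def segment_def)

lemma is_struct_canonical: "is_struct (fst (canonical q))"
  by (force simp: is_struct_def canonical_def vars_def)

text \<open>Without \<open>0\<close> the query is a tree numbered away from its root
  \<open>1\<close>, so an edge is recovered from its larger end; \<open>0\<close> itself dominates
  all other variables.\<close>

lemma comb_in_class:
  assumes "0 < L"
  shows "comb L \<in> c_acyclic_c_connected_cqs"
proof -
  define A where "A = fst (canonical (comb L))"
  have can: "canonical (comb L) = (A, 0)"
    by (simp add: A_def canonical_def comb_def)
  have Rel: "Rel A = (\<Union>n<L. set (segment n))"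
    by (simp add: A_def canonical_def set_atoms_comb)
  have Dom: "Dom A = vars (comb L)" by (simp add: A_def canonical_def)
  have "c_acyclic (A, 0)"
  proof (rule c_acyclicI_inj_on_max)
    show "(u, u) \<notin> Rel A" for u :: nat
      by (auto simp: Rel segment_def orient_def)
    \<comment> \<open>\<open>edge m k\<close> is the edge of segment \<open>m\<close> with larger
      end \<open>k\<close>, for \<open>k\<close> from \<open>3 * m + 2\<close> to
      \<open>3 * m + 4\<close>.\<close>
    define edge where "edge m k =
      (if k = 3 * m + 2 then orient (tail_out m) (3 * m + 1) (3 * m + 2)
       else if k = 3 * m + 3 then orient (tail_out m) (3 * m + 2) (3 * m + 3)
       else orient (forward m) (3 * m + 1) (3 * m + 4))" for m k
    have max: "f = edge m (max (fst f) (snd f))"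
        "3 * m + 2 \<le> max (fst f) (snd f)" "max (fst f) (snd f) \<le> 3 * m + 4"
      if "f \<in> set (segment m)" "fst f \<noteq> 0" for f m
    proof -
      have *: "max (fst (orient b u v)) (snd (orient b u v)) = max u v" for b u v
        by (simp add: orient_def max.commute)
      have "f = orient (tail_out m) (3 * m + 1) (3 * m + 2) \<or>
          f = orient (tail_out m) (3 * m + 2) (3 * m + 3) \<or> f = orient (forward m) (3 * m + 1) (3 * m + 4)"
        using that unfolding segment_def list.set by (elim insertE emptyE) simp_all
      then show "f = edge m (max (fst f) (snd f))"
          "3 * m + 2 \<le> max (fst f) (snd f)" "max (fst f) (snd f) \<le> 3 * m + 4"
        by (elim disjE; simp add: * edge_def)+
    qed
    have eq: "f = f'"
      if f: "f \<in> set (segment n)" "fst f \<noteq> 0" and f': "f' \<in> set (segment n')" "fst f' \<noteq> 0"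
        and same: "max (fst f) (snd f) = max (fst f') (snd f')" for f f' n n'
    proof -
      \<comment> \<open>The ranges of larger ends of different segments are disjoint.\<close>
      have "n = n'" using max(2,3)[OF f] max(2,3)[OF f'] unfolding same by linarith
      then show ?thesis using max(1)[OF f] max(1)[OF f'] same by metis
    qed
    show "inj_on (\<lambda>(u, v). max u v) {(u, v) \<in> Rel A. u \<noteq> 0 \<and> v \<noteq> 0}"
    proof (rule inj_onI)
      fix f f'
      assume f: "f \<in> {(u, v) \<in> Rel A. u \<noteq> 0 \<and> v \<noteq> 0}" "f' \<in> {(u, v) \<in> Rel A. u \<noteq> 0 \<and> v \<noteq> 0}"
        and same: "(case f of (u, v) \<Rightarrow> max u v) = (case f' of (u, v) \<Rightarrow> max u v)"
      from f obtain n n' where "f \<in> set (segment n)" "f' \<in> set (segment n')"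
        by (auto simp: Rel)
      moreover have "fst f \<noteq> 0" "fst f' \<noteq> 0" using f by auto
      moreover have "max (fst f) (snd f) = max (fst f') (snd f')" using same by (simp add: case_prod_beta)
      ultimately show "f = f'" by (intro eq)
    qed
  qed
  moreover have "c_connected (A, 0)"
  proof (rule c_connectedI_dominating)
    show "is_struct A" by (simp add: A_def is_struct_canonical)
    show "0 \<in> Dom A"
      using is_cq_comb[OF assms] by (simp add: Dom is_cq_def comb_def)
    \<comment> \<open>Each segment also contains \<open>(0, 3 * n + 4)\<close>, which covers the
      final spine variable.\<close>
    show "(0, v) \<in> Rel A" if v: "v \<in> Dom A" and "v \<noteq> 0" for v
    proof -
      from v obtain n f where n: "n < L" "f \<in> set (segment n)" "v = fst f \<or> v = snd f"
        by (auto simp: Dom vars_def set_atoms_comb)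
      with \<open>v \<noteq> 0\<close> have "(0, v) \<in> set (segment n)"
        by (auto simp: segment_def orient_def split: if_splits)
      with n show ?thesis by (auto simp: Rel)
    qed
  qed
  ultimately show ?thesis
    using is_cq_comb[OF assms] by (simp add: c_acyclic_c_connected_cqs_def can)
qed

text \<open>The list \<open>c\<close> labels the spine periodically, and labels rise by one along
  each tail edge. Both lists used below have entries at least 3 at \<open>a\<close> and
  \<open>c\<close>, so the truncated subtraction of at most 2 is exact and leaves positive labels,
  as edges from \<open>0\<close> require.\<close>

definition labelling :: "nat list \<Rightarrow> nat \<Rightarrow> nat" where
  "labelling c v =
     (if v = 0 then 0
      else let n = (v - 1) div 3; r = (v - 1) mod 3; s = c ! (n mod 4)
           in if tail_out n then s + r else s - r)"

lemma labelling_simps: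
  "labelling c 0 = 0"
  "labelling c (3 * n + 1) = c ! (n mod 4)"
  "labelling c (3 * n + 2) = (if tail_out n then c ! (n mod 4) + 1 else c ! (n mod 4) - 1)"
  "labelling c (3 * n + 3) = (if tail_out n then c ! (n mod 4) + 2 else c ! (n mod 4) - 2)"
  "labelling c (3 * n + 4) = c ! (Suc n mod 4)"
proof -
  have main: "labelling c v = (if tail_out m then c ! (m mod 4) + r else c ! (m mod 4) - r)"
    if "v = 3 * m + r + 1" "r < 3" for v m r
  proof -
    have "(v - 1) div 3 = m" "(v - 1) mod 3 = r" "v \<noteq> 0" using that by simp_all
    then show ?thesis by (simp only: labelling_def Let_def if_False)
  qed
  show "labelling c 0 = 0" by (simp add: labelling_def)
  show "labelling c (3 * n + 1) = c ! (n mod 4)"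
    using main[of "3 * n + 1" n 0] by simp
  show "labelling c (3 * n + 2) = (if tail_out n then c ! (n mod 4) + 1 else c ! (n mod 4) - 1)"
    using main[of "3 * n + 2" n 1] by simp
  show "labelling c (3 * n + 3) = (if tail_out n then c ! (n mod 4) + 2 else c ! (n mod 4) - 2)"
    using main[of "3 * n + 3" n 2] by simp
  show "labelling c (3 * n + 4) = c ! (Suc n mod 4)"
    using main[of "3 * n + 4" "Suc n" 0] by simp
qed

lemma segment_cases:
  obtains "n mod 4 = 0" "Suc n mod 4 = 1" "\<not> tail_out n" "forward n"
    | "n mod 4 = 1" "Suc n mod 4 = 2" "\<not> tail_out n" "\<not> forward n"
    | "n mod 4 = 2" "Suc n mod 4 = 3" "tail_out n" "\<not> forward n"
    | "n mod 4 = 3" "Suc n mod 4 = 0" "tail_out n" "forward n"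
proof -
  have "n mod 4 = 0 \<and> Suc n mod 4 = 1 \<or> n mod 4 = 1 \<and> Suc n mod 4 = 2
    \<or> n mod 4 = 2 \<and> Suc n mod 4 = 3 \<or> n mod 4 = 3 \<and> Suc n mod 4 = 0" by presburger
  then show thesis
    by (elim disjE conjE) (use that in \<open>simp_all add: tail_out_def forward_def\<close>)
qed

text \<open>
  The lists give the labels of the spine vertices \<open>a\<close>, \<open>c\<close>, \<open>b\<close>, \<open>d\<close>. In \<open>[3, 4, 3, 2]\<close> the label is
  the index \<open>i\<close> of the variable \<open>y\<^sub>i\<close>; in \<open>[3, 4, 2, 1]\<close> it is one plus the length of a longest
  directed path that avoids \<open>x\<close> and ends in the vertex.
\<close>

lemma labelling_levels:
  "\<forall>(u, v) \<in> set (segment n).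
     (labelling [3, 4, 3, 2] u, labelling [3, 4, 3, 2] v) \<in> set (atoms T'')"
  by (cases n rule: segment_cases)
    (simp_all only: segment_def orient_def list.set ball_simps prod.case if_True if_False
      labelling_simps, simp_all add: T''_def)

lemma labelling_tournament:
  "\<forall>(u, v) \<in> set (segment n).
     labelling [3, 4, 2, 1] u < labelling [3, 4, 2, 1] v \<and> labelling [3, 4, 2, 1] v \<le> 4"
  by (cases n rule: segment_cases)
    (simp_all only: segment_def orient_def list.set ball_simps prod.case if_True if_False
      labelling_simps, simp_all)

section \<open>Positive examples and inequivalence\<close>

lemma comb_positive:
  assumes "is_pstruct E" "positive_example T'' E" "0 < L"
  shows "positive_example (comb L) E"
proof -
  from assms(2) obtain h where h: "h (answer_var T'') = snd E"
    "\<forall>(u, v) \<in> set (atoms T''). (h u, h v) \<in> Rel (fst E)"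
    by (rule positive_exampleE)
  show ?thesis
  proof (rule positive_exampleI[where h = "h \<circ> labelling [3, 4, 3, 2]"])
    show "(h \<circ> labelling [3, 4, 3, 2]) (answer_var (comb L)) = snd E"
      using h(1) by (simp add: comb_def T''_def labelling_simps)
    show "((h \<circ> labelling [3, 4, 3, 2]) u, (h \<circ> labelling [3, 4, 3, 2]) v) \<in> Rel (fst E)"
      if "(u, v) \<in> set (atoms (comb L))" for u v
      using that h(2) labelling_levels by (fastforce simp: set_atoms_comb)
  qed (use assms is_cq_comb in \<open>auto simp: is_pstruct_def\<close>)
qed

lemma comb_not_equivalent:
  assumes "0 < L"
  shows "\<not> logically_equivalent (comb L) T''"
proof
  \<comment> \<open>The transitive tournament on 1 to 4, dominated by the distinguished element
    0.\<close>
  define A :: "nat struct" where "A = \<lparr>Dom = {..4}, Rel = {(i, j). i < j \<and> j \<le> 4}\<rparr>"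
  assume "logically_equivalent (comb L) T''"
  moreover have A: "is_struct A" by (auto simp: A_def is_struct_def)
  moreover have "positive_example (comb L) (A, 0)"
  proof (rule positive_exampleI[where h = "labelling [3, 4, 2, 1]"])
    show "(labelling [3, 4, 2, 1] u, labelling [3, 4, 2, 1] v) \<in> Rel (fst (A, 0 :: nat))"
      if "(u, v) \<in> set (atoms (comb L))" for u v
      using that labelling_tournament by (fastforce simp: set_atoms_comb A_def)
  qed (use assms A is_cq_comb in \<open>auto simp: comb_def labelling_simps\<close>)
  ultimately have "positive_example T'' (A, 0)"
    by (auto simp: logically_equivalent_def positive_example_def)
  then obtain h where "h (answer_var T'') = snd (A, 0)"
    "\<forall>(u, v) \<in> set (atoms T''). (h u, h v) \<in> Rel (fst (A, 0 :: nat))"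
    by (rule positive_exampleE)
  \<comment> \<open>The images of the path variables would be five strictly increasing numbers
    between 1 and 4.\<close>
  then show False by (auto simp: T''_def A_def)
qed

section \<open>Negative examples and the spine walk\<close>

lemma comb_negative:
  assumes E: "is_pstruct E" and acyclic: "c_acyclic E" and neg: "\<not> positive_example T'' E"
    and card: "card (Dom (fst E)) < L"
  shows "\<not> positive_example (comb L) E"
proof
  let ?R = "Rel (fst E)"
  assume "positive_example (comb L) E"
  then obtain h where h: "h (answer_var (comb L)) = snd E"
    and hom: "\<forall>(u, v) \<in> set (atoms (comb L)). (h u, h v) \<in> ?R"
    by (rule positive_exampleE)
  have h0: "h 0 = snd E" using h by (simp add: comb_def)
  have struct: "is_struct (fst E)" using E by (simp add: is_pstruct_def)
  have seg: "(h u, h v) \<in> ?R" if "n < L" "(u, v) \<in> set (segment n)" for n u v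
    using hom that by (auto simp: set_atoms_comb)
  have root: "(snd E, h (3 * n + 1)) \<in> ?R" "(snd E, h (3 * n + 2)) \<in> ?R"
    "(snd E, h (3 * n + 3)) \<in> ?R" if "n < L" for n
    using seg[of n 0, OF that] by (auto simp: segment_def h0)
  have tail: "(h (3 * n + 1), h (3 * n + 2)) \<in> ?R \<and> (h (3 * n + 2), h (3 * n + 3)) \<in> ?R"
    if "n < L" "tail_out n" for n
    using seg[OF that(1)] that(2) by (auto simp: segment_def orient_def)
  have tail': "(h (3 * n + 3), h (3 * n + 2)) \<in> ?R \<and> (h (3 * n + 2), h (3 * n + 1)) \<in> ?R"
    if "n < L" "\<not> tail_out n" for n
    using seg[OF that(1)] that(2) by (auto simp: segment_def orient_def)
  \<comment> \<open>A loop at an out-neighbour of the distinguished element would absorb the whole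
    path of \<open>T''\<close>.\<close>
  have loop: "(y, y) \<notin> ?R" if "(snd E, y) \<in> ?R" for y
    using positive_example_T''I[OF struct, of y y y y y] that neg by auto
  define w where "w n = h (3 * n + 1)" for n
  have w: "(snd E, w n) \<in> ?R" if "n < L" for n using root that by (simp add: w_def)
  \<comment> \<open>The tail entering \<open>w n\<close>, followed by the tail leaving
    \<open>w m\<close>, would be a path on five out-neighbours of the distinguished element.\<close>
  have tails_differ: "w n \<noteq> w m" if "n < L" "m < L" "\<not> tail_out n" "tail_out m" for n m
  proof
    assume "w n = w m"
    then show False
      using positive_example_T''I[OF struct, of "h (3 * n + 3)" "h (3 * n + 2)" "w n" "h (3 * m + 2)" "h (3 * m + 3)"]
        tail[of m] tail'[of n] root[of n] root[of m] that neg by (auto simp: w_def)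
  qed
  have adj: "(w n, w (Suc n)) \<in> ?R \<or> (w (Suc n), w n) \<in> ?R" if "Suc n < L" for n
  proof -
    have "orient (forward n) (3 * n + 1) (3 * n + 4) \<in> set (segment n)" by (simp add: segment_def)
    then show ?thesis
      using seg[of n] that by (auto simp: w_def orient_def add.commute split: if_splits)
  qed
  obtain vs es where "incidence_cycle (fst E) vs es" and vs: "\<And>u. Inl u \<in> set vs \<Longrightarrow> u \<in> w ` {..<L}"
  proof (rule incidence_cycle_of_nonbacktracking_walk[of "fst E" w L])
    show "w ` {..<L} \<subseteq> Dom (fst E)" using w struct by (auto simp: is_struct_def)
    show "w n \<noteq> w (Suc n)" if "Suc n < L" for n
      using adj[OF that] loop w[of n] that by auto
    show "w n \<noteq> w (Suc (Suc n))" if "Suc (Suc n) < L" for n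
    proof -
      \<comment> \<open>Shifting by two exchanges the residues 0, 1 with 2, 3.\<close>
      have "tail_out n \<longleftrightarrow> \<not> tail_out (Suc (Suc n))" unfolding tail_out_def by presburger
      then show ?thesis
        using tails_differ[of n "Suc (Suc n)"] tails_differ[of "Suc (Suc n)" n] that by auto
    qed
  qed (use struct card adj in \<open>auto simp: is_struct_def\<close>)
  \<comment> \<open>The cycle must meet the distinguished element, which is then a spine image and
    hence its own out-neighbour, contradicting \<open>loop\<close>.\<close>
  then obtain n where "n < L" "snd E = w n" using acyclic by (force simp: c_acyclic_def)
  then show False using w[of n] loop[of "w n"] by simp
qed

theorem theorem4p9:
  "\<not> (\<exists>(Epos :: 'a pstruct set) (Eneg :: 'a pstruct set).
        finite Epos \<and> finite Eneg \<and>
        (\<forall>E \<in> Epos \<union> Eneg. is_pstruct E \<and> c_acyclic E) \<and>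
        uniquely_characterizes Epos Eneg T'' c_acyclic_c_connected_cqs)"
proof
  assume "\<exists>(Epos :: 'a pstruct set) (Eneg :: 'a pstruct set).
        finite Epos \<and> finite Eneg \<and>
        (\<forall>E \<in> Epos \<union> Eneg. is_pstruct E \<and> c_acyclic E) \<and>
        uniquely_characterizes Epos Eneg T'' c_acyclic_c_connected_cqs"
  then obtain Epos Eneg :: "'a pstruct set" where fin: "finite Eneg"
    and ex: "\<forall>E \<in> Epos \<union> Eneg. is_pstruct E \<and> c_acyclic E"
    and char: "uniquely_characterizes Epos Eneg T'' c_acyclic_c_connected_cqs"
    by blast
  \<comment> \<open>The sum over the finite set \<open>Eneg\<close> bounds all sizes at once; the
    successor makes the bound strict and \<open>L\<close> positive.\<close>
  define L where "L = Suc (\<Sum>E\<in>Eneg. card (Dom (fst E)))"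
  have L: "0 < L" by (simp add: L_def)
  have card: "card (Dom (fst E)) < L" if "E \<in> Eneg" for E
    using member_le_sum[OF that, of "\<lambda>E. card (Dom (fst E))"] fin by (simp add: L_def less_Suc_eq_le)
  have "fits Epos Eneg (comb L)"
    using char ex card comb_positive[OF _ _ L] comb_negative
    unfolding uniquely_characterizes_def fits_def by blast
  then show False
    using char comb_in_class[OF L] comb_not_equivalent[OF L]
    unfolding uniquely_characterizes_def by blast
qed

end
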